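(* Let $d\ge1$ be an integer, let $\beta>0$, and let $\Xi$ be the distribution on $[0,\infty)$ with density $f_\beta(x)=\frac{\beta}{(x+1)^{\beta+1}}$, $x\ge 0$. Let $\mathbf{x}_1,\mathbf{x}_2,\ldots\in\mathbb{R}^d$ be generated by the preferential placement process with step distribution $\Xi$ (defined in the context), let $$ X_\delta(n)=\frac1n\sum_{i=1}^n\|\mathbf{x}_i\|^\delta , $$ and let $\xi$ be a random variable with distribution $\Xi$. (i) For any $\delta$ with $1\le\delta<\min\{\beta,2\}$, $$ \mathbb{E}X_\delta(n)\le \mathbb{E}\xi^\delta\sum_{t=2}^n\frac1t\sim \mathbb{E}\xi^\delta\,\log n . $$ (ii) If $\beta>2$, then $$ \mathbb{E}X_2(n)=\mathbb{E}\xi^2\sum_{t=2}^n\frac1t\sim\mathbb{E}\xi^2\,\log n . $$ Here the (in)equalities hold for every $n\ge1$ (an empty sum being $0$), and $\sim$ means that the ratio tends to $1$ as $n\to\infty$.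
   Context: Preferential placement process. $\|\cdot\|$ is the Euclidean norm on $\mathbb{R}^d$. Set $\mathbf{x}_1=0$ (the origin). Given $\mathbf{x}_1,\ldots,\mathbf{x}_t$ ($t\ge1$), the point $\mathbf{x}_{t+1}$ is obtained as follows: choose an index $i_{t+1}$ uniformly at random from $\{1,\ldots,t\}$, sample $\xi_{t+1}$ from $\Xi$, sample $\mathbf{e}_{t+1}$ uniformly from the unit sphere $\{\mathbf{e}\in\mathbb{R}^d:\|\mathbf{e}\|=1\}$, and set $\mathbf{x}_{t+1}=\mathbf{x}_{i_{t+1}}+\xi_{t+1}\mathbf{e}_{t+1}$. All the choices $i_{t},\xi_{t},\mathbf{e}_{t}$, $t\ge2$, are mutually independent. *)

theory Defs
  imports "HOL-Probability.Probability"
begin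

(* Normalised surface measure on the unit sphere, obtained as the normalised cone measure:
   the direction x / norm x of a point x uniform in the unit ball.  The point x = 0,
   where sgn x = 0, is a null set.  In dimension 1 this is the fair choice between the
   two unit vectors. *)
definition sphere_uniform :: "'a::euclidean_space measure" where
  "sphere_uniform = distr (uniform_measure lborel (ball 0 1)) borel sgn"

lemma measurable_sgn_ball:
  "sgn \<in> measurable (uniform_measure lborel (ball 0 1)) (borel :: 'a::euclidean_space measure)"
  unfolding sgn_div_norm by simp

lemma prob_space_sphere_uniform: "prob_space (sphere_uniform :: 'a::euclidean_space measure)"
proof -
  have "emeasure lborel (ball (0::'a) 1) \<noteq> 0"
    using content_ball_pos[of 1 "0::'a"] by (auto simp: measure_def)
  moreover have "emeasure lborel (ball (0::'a) 1) \<noteq> \<infinity>"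
    using emeasure_lborel_ball_finite[of "0::'a" 1] by simp
  ultimately have "prob_space (uniform_measure lborel (ball (0::'a) 1))"
    by (rule prob_space_uniform_measure)
  then show ?thesis
    unfolding sphere_uniform_def
    by (rule prob_space.prob_space_distr[OF _ measurable_sgn_ball])
qed

lemma AE_sphere_uniform_norm: "AE e in (sphere_uniform :: 'a::euclidean_space measure). norm e = 1"
proof -
  have "AE x in lborel. x \<in> ball (0::'a) 1 \<longrightarrow> norm (sgn x) = 1"
    using AE_lborel_singleton[of "0::'a"] by (rule eventually_mono) (simp add: norm_sgn)
  then show ?thesis
    unfolding sphere_uniform_def
    by (subst AE_distr_iff[OF measurable_sgn_ball]) (auto intro!: AE_uniform_measureI)
qed

definition step_density :: "real \<Rightarrow> real \<Rightarrow> real" where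
  "step_density \<beta> x = (if 0 \<le> x then \<beta> / (x + 1) powr (\<beta> + 1) else 0)"

definition step_distribution :: "real \<Rightarrow> real measure" where
  "step_distribution \<beta> = density lborel (\<lambda>x. ennreal (step_density \<beta> x))"

datatype choice = Index | Step | Direction

(* Events determined by the choice Z with values in N. *)
definition events_of :: "'w measure \<Rightarrow> 'b measure \<Rightarrow> ('w \<Rightarrow> 'b) \<Rightarrow> 'w set set" where
  "events_of M N Z = {Z -` A \<inter> space M |A. A \<in> sets N}"

(* Times start at 1, so x 0 is unconstrained and the random choices are used for t >= 2 only.
   The choices take values in different types, hence mutual independence is expressed through
   the sigma-algebras they generate rather than through indep_vars.  Measurability of idx t into
   count_space {1..<t} makes idx t take values in {1..<t} everywhere, so that
   x is determined by the recursion on the whole sample space. *)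
locale preferential_placement = prob_space M
  for M :: "'w measure"
  and \<Xi> :: "real measure"
  and idx :: "nat \<Rightarrow> 'w \<Rightarrow> nat"
  and step :: "nat \<Rightarrow> 'w \<Rightarrow> real"
  and dir :: "nat \<Rightarrow> 'w \<Rightarrow> 'a::euclidean_space"
  and x :: "nat \<Rightarrow> 'w \<Rightarrow> 'a" +
  assumes idx_measurable: "\<And>t. t \<ge> 2 \<Longrightarrow> idx t \<in> measurable M (count_space {1..<t})"
    and idx_uniform:
      "\<And>t. t \<ge> 2 \<Longrightarrow> distr M (count_space {1..<t}) (idx t) = uniform_count_measure {1..<t}"
    and step_measurable: "\<And>t. t \<ge> 2 \<Longrightarrow> step t \<in> borel_measurable M"
    and step_distr: "\<And>t. t \<ge> 2 \<Longrightarrow> distr M borel (step t) = \<Xi>"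
    and dir_measurable: "\<And>t. t \<ge> 2 \<Longrightarrow> dir t \<in> borel_measurable M"
    and dir_uniform: "\<And>t. t \<ge> 2 \<Longrightarrow> distr M borel (dir t) = sphere_uniform"
    and choices_indep:
      "indep_sets
         (\<lambda>(t, c). case c of
            Index \<Rightarrow> events_of M (count_space {1..<t}) (idx t)
          | Step \<Rightarrow> events_of M borel (step t)
          | Direction \<Rightarrow> events_of M borel (dir t))
         ({2..} \<times> UNIV)"
    and x_first: "\<And>\<omega>. \<omega> \<in> space M \<Longrightarrow> x 1 \<omega> = 0"
    and x_next: "\<And>t \<omega>. t \<ge> 1 \<Longrightarrow> \<omega> \<in> space M \<Longrightarrow>
      x (Suc t) \<omega> = x (idx (Suc t) \<omega>) \<omega> + step (Suc t) \<omega> *\<^sub>R dir (Suc t) \<omega>"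

definition mean_norm_powr ::
    "(nat \<Rightarrow> 'w \<Rightarrow> 'a::real_normed_vector) \<Rightarrow> real \<Rightarrow> nat \<Rightarrow> 'w \<Rightarrow> real" where
  "mean_norm_powr x \<delta> n \<omega> = (1 / real n) * (\<Sum>i=1..n. norm (x i \<omega>) powr \<delta>)"

end

theory Submission
  imports Defs "HOL-Real_Asymp.Real_Asymp"
begin

text \<open>For \<open>0 < \<delta> \<le> 2\<close>, concavity and subadditivity of \<open>u \<mapsto> u powr (\<delta> / 2)\<close> turn the parallelogram
  law into \<open>\<parallel>a + v\<parallel>\<^sup>\<delta> + \<parallel>a - v\<parallel>\<^sup>\<delta> \<le> 2 (\<parallel>a\<parallel>\<^sup>\<delta> + \<parallel>v\<parallel>\<^sup>\<delta>)\<close>, with equality for \<open>\<delta> = 2\<close>. The direction of a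
  step is symmetric and independent of the parent and the step length, so the expectation of
  \<open>\<parallel>x\<^sub>t\<^sub>+\<^sub>1\<parallel>\<^sup>\<delta>\<close> is at most that of \<open>\<parallel>parent\<parallel>\<^sup>\<delta>\<close> plus that of \<open>\<xi>\<^sup>\<delta>\<close>. As the parent is uniform among
  the first \<open>t\<close> points, the former is \<open>E X\<^sub>\<delta>(t)\<close>, and hence
  \<open>E X\<^sub>\<delta>(t + 1) \<le> E X\<^sub>\<delta>(t) + E \<xi>\<^sup>\<delta> / (t + 1)\<close>.\<close>

section \<open>Power inequalities with exponent at most 1, and their consequence for norms\<close>

lemma powr_tangent_le:
  fixes z p :: real
  assumes "0 \<le> z" "0 < p" "p \<le> 1"
  shows "z powr p \<le> 1 + p * (z - 1)"
proof (cases "z = 0")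
  case False
  then show ?thesis
    \<comment> \<open>Weighted AM-GM for \<open>z\<close> and \<open>1\<close> with weights
      \<open>p\<close> and \<open>1 - p\<close>; it needs \<open>z > 0\<close>, hence the case
      split.\<close>
    using Youngs_inequality_0[of p "1 - p" z 1] assms by (simp add: algebra_simps)
qed (use assms in auto)

text \<open>After division by the mean \<open>s\<close>, both arguments are bounded by the tangent
  at 1. The linear parts cancel because \<open>u / s + v / s = 2\<close>.\<close>

lemma powr_sum_le_midpoint:
  fixes u v p :: real
  assumes "0 \<le> u" "0 \<le> v" "0 < p" "p \<le> 1"
  shows "u powr p + v powr p \<le> 2 * ((u + v) / 2) powr p"
proof (cases "u + v = 0")
  case False
  define s where "s = (u + v) / 2"
  have s: "s > 0" using False assms by (simp add: s_def)
  have "(u / s) powr p + (v / s) powr p \<le> (1 + p * (u / s - 1)) + (1 + p * (v / s - 1))"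
    using assms s by (intro add_mono powr_tangent_le) auto
  also have "\<dots> = 2 + p * ((u + v) / s - 2)"
    by (simp add: algebra_simps add_divide_distrib)
  also have "(u + v) / s = 2"
    using s unfolding s_def by (subst divide_eq_eq) auto
  finally have "(u / s) powr p + (v / s) powr p \<le> 2" by simp
  then show ?thesis
    using assms s unfolding s_def[symmetric] by (simp add: powr_divide field_simps)
qed (use assms in \<open>auto simp: add_nonneg_eq_0_iff\<close>)

text \<open>By homogeneity the sum may be scaled to 1; both summands then lie in the unit interval,
  where \<open>y \<le> y powr p\<close>.\<close>

lemma powr_add_le_add_powr:
  fixes u v p :: real
  assumes "0 \<le> u" "0 \<le> v" "0 < p" "p \<le> 1"
  shows "(u + v) powr p \<le> u powr p + v powr p"
proof (cases "u + v = 0")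
  case False
  then have s: "u + v > 0" using assms by simp
  have *: "y \<le> y powr p" if "0 \<le> y" "y \<le> 1" for y :: real
    using powr_mono'[of p 1 y] that assms by simp
  have "u / (u + v) + v / (u + v) \<le> (u / (u + v)) powr p + (v / (u + v)) powr p"
    using assms s by (intro add_mono *) auto
  moreover have "u / (u + v) + v / (u + v) = 1"
    using s by (simp add: add_divide_distrib[symmetric])
  ultimately show ?thesis
    using assms s by (simp add: powr_divide field_simps)
qed (use assms in auto)

lemma parallelogram_law:
  fixes a v :: "'a::real_inner"
  shows "(norm (a + v))\<^sup>2 + (norm (a - v))\<^sup>2 = 2 * ((norm a)\<^sup>2 + (norm v)\<^sup>2)"
  by (simp add: power2_norm_eq_inner inner_add inner_diff inner_commute algebra_simps)

lemma norm_powr_parallelogram_le: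
  fixes a v :: "'a::real_inner"
  assumes "0 < \<delta>" "\<delta> \<le> 2"
  shows "norm (a + v) powr \<delta> + norm (a - v) powr \<delta> \<le> 2 * (norm a powr \<delta> + norm v powr \<delta>)"
proof -
  have sq: "norm w powr \<delta> = ((norm w)\<^sup>2) powr (\<delta> / 2)" for w :: 'a
  proof -
    have "(norm w)\<^sup>2 = norm w powr 2" by simp
    then show ?thesis by (simp only: powr_powr) simp
  qed
  have "norm (a + v) powr \<delta> + norm (a - v) powr \<delta>
      \<le> 2 * (((norm (a + v))\<^sup>2 + (norm (a - v))\<^sup>2) / 2) powr (\<delta> / 2)"
    unfolding sq using assms by (intro powr_sum_le_midpoint) auto
  also have "\<dots> = 2 * ((norm a)\<^sup>2 + (norm v)\<^sup>2) powr (\<delta> / 2)"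
    unfolding parallelogram_law by (subst nonzero_mult_div_cancel_left) auto
  also have "\<dots> \<le> 2 * (norm a powr \<delta> + norm v powr \<delta>)"
    unfolding sq using assms by (intro mult_left_mono powr_add_le_add_powr) auto
  finally show ?thesis .
qed

lemma norm_powr_2_parallelogram:
  fixes a v :: "'a::real_inner"
  shows "norm (a + v) powr 2 + norm (a - v) powr 2 = 2 * (norm a powr 2 + norm v powr 2)"
  using parallelogram_law[of a v] by simp

section \<open>Reflection symmetry of the uniform direction\<close>

lemma sets_sphere_uniform [measurable_cong]: "sets sphere_uniform = sets borel"
  by (simp add: sphere_uniform_def)

text \<open>As \<open>sgn\<close> is odd and the ball is symmetric, the claim reduces to the
  invariance of Lebesgue measure under \<open>y \<mapsto> - y\<close>, which is
  \<open>lborel_affine\<close> with factor -1.\<close>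

lemma distr_sphere_uniform_uminus:
  "distr sphere_uniform borel uminus = (sphere_uniform :: 'a::euclidean_space measure)"
proof (rule measure_eqI)
  fix A :: "'a set" assume "A \<in> sets (distr sphere_uniform borel uminus)"
  then have A [measurable]: "A \<in> sets borel" by simp
  have sgn_meas [measurable]: "sgn \<in> borel_measurable (borel :: 'a measure)"
    unfolding sgn_div_norm by measurable
  have ball_meas [measurable]: "ball (0::'a) 1 \<in> sets borel" by simp
  define f :: "'a \<Rightarrow> ennreal" where "f y = indicator A (sgn y) * indicator (ball 0 1) y" for y
  have f_meas [measurable]: "f \<in> borel_measurable borel"
    unfolding f_def by measurable
  have emeasure_eq: "emeasure sphere_uniform B
      = (\<integral>\<^sup>+y. indicator B (sgn y) * indicator (ball 0 1) y \<partial>lborel) / emeasure lborel (ball (0::'a) 1)"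
    if [measurable]: "B \<in> sets borel" for B :: "'a set"
    unfolding sphere_uniform_def
    by (subst nn_integral_indicator[symmetric], simp, subst nn_integral_distr, simp_all,
        subst nn_integral_uniform_measure, simp_all)
  have "emeasure (distr sphere_uniform borel uminus) A = emeasure sphere_uniform (uminus -` A)"
    by (subst emeasure_distr) (auto simp: sphere_uniform_def)
  also have "\<dots> = (\<integral>\<^sup>+y. f (- y) \<partial>lborel) / emeasure lborel (ball (0::'a) 1)"
    by (subst emeasure_eq)
      (auto simp: f_def sgn_minus indicator_def intro!: arg_cong2[where f="(/)"] nn_integral_cong
        measurable_sets_borel[of uminus borel])
  also have "(\<integral>\<^sup>+y. f (- y) \<partial>lborel) = (\<integral>\<^sup>+y. f y \<partial>lborel)"
    by (subst (2) lborel_affine[of "-1" 0]) (simp_all add: nn_integral_density nn_integral_distr)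
  also have "\<dots> / emeasure lborel (ball (0::'a) 1) = emeasure sphere_uniform A"
    by (simp add: emeasure_eq f_def)
  finally show "emeasure (distr sphere_uniform borel uminus) A = emeasure sphere_uniform A" .
qed (simp add: sphere_uniform_def)

section \<open>Moments of the step distribution\<close>

lemma measurable_step_density [measurable]: "step_density \<beta> \<in> borel_measurable borel"
  unfolding step_density_def by measurable

lemma step_density_nonneg: "0 < \<beta> \<Longrightarrow> 0 \<le> step_density \<beta> y"
  by (simp add: step_density_def)

lemma sets_step_distribution [measurable_cong]: "sets (step_distribution \<beta>) = sets borel"
  by (simp add: step_distribution_def)

text \<open>Replacing \<open>y powr \<delta>\<close> by the larger
  \<open>(y + 1) powr \<delta>\<close> gives the integrand \<open>g\<close> on the half-line. Its
  antiderivative \<open>F\<close> vanishes at infinity since \<open>\<delta> < \<beta>\<close>, so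
  the dominating integral is \<open>- F 0 = \<beta> / (\<beta> - \<delta>)\<close>.\<close>

lemma integrable_step_distribution_powr:
  assumes "0 < \<delta>" "\<delta> < \<beta>"
  shows "integrable (step_distribution \<beta>) (\<lambda>y. y powr \<delta>)"
proof -
  define F where "F y = \<beta> / (\<delta> - \<beta>) * (y + 1) powr (\<delta> - \<beta>)" for y :: real
  define g where "g y = \<beta> * (y + 1) powr (\<delta> - \<beta> - 1)" for y :: real
  have "(\<integral>\<^sup>+y. ennreal (g y) * indicator {0..} y \<partial>lborel) = ennreal (0 - F 0)"
  proof (rule nn_integral_FTC_atLeast)
    show "DERIV F y :> g y" if "0 \<le> y" for y
    proof -
      have "DERIV (\<lambda>y. y + 1) y :> 1"
        by (auto intro!: derivative_eq_intros)
      from DERIV_fun_powr[OF this, of "\<delta> - \<beta>"] that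
      have "DERIV (\<lambda>y. (y + 1) powr (\<delta> - \<beta>)) y :> (\<delta> - \<beta>) * (y + 1) powr (\<delta> - \<beta> - 1)"
        by simp
      from DERIV_cmult[OF this, of "\<beta> / (\<delta> - \<beta>)"] show ?thesis
        unfolding F_def g_def using assms by simp
    qed
    show "(F \<longlongrightarrow> 0) at_top"
      unfolding F_def using assms by real_asymp
  qed (use assms in \<open>auto simp: g_def\<close>)
  also have "(\<integral>\<^sup>+y. ennreal (g y) * indicator {0..} y \<partial>lborel)
      = (\<integral>\<^sup>+y. ennreal (norm (g y * indicator {0..} y)) \<partial>lborel)"
    using assms by (intro nn_integral_cong) (auto simp: g_def indicator_def)
  finally have "integrable lborel (\<lambda>y. g y * indicator {0..} y)"
    by (intro integrableI_bounded) (auto simp: g_def)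
  then have "integrable lborel (\<lambda>y. step_density \<beta> y *\<^sub>R y powr \<delta>)"
  proof (rule Bochner_Integration.integrable_bound)
    have "step_density \<beta> y * y powr \<delta> \<le> g y * indicator {0..} y" for y
    proof (cases "0 \<le> y")
      case True
      have "y powr \<delta> / (y + 1) powr (\<beta> + 1) \<le> (y + 1) powr \<delta> / (y + 1) powr (\<beta> + 1)"
        using True assms by (intro divide_right_mono powr_mono2) auto
      also have "\<dots> = (y + 1) powr (\<delta> - \<beta> - 1)"
        by (simp add: powr_diff[symmetric] algebra_simps)
      finally have "\<beta> * (y powr \<delta> / (y + 1) powr (\<beta> + 1)) \<le> \<beta> * (y + 1) powr (\<delta> - \<beta> - 1)"
        using assms by (intro mult_left_mono) auto
      then show ?thesis
        using True by (simp add: step_density_def g_def)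
    qed (simp add: step_density_def)
    moreover have "0 \<le> step_density \<beta> y * y powr \<delta>" for y
      using assms by (simp add: step_density_nonneg)
    ultimately show "AE y in lborel. norm (step_density \<beta> y *\<^sub>R y powr \<delta>) \<le> norm (g y * indicator {0..} y)"
      by (intro AE_I2) (simp only: real_norm_def real_scaleR_def abs_of_nonneg order_trans[OF _ abs_ge_self])
  qed simp
  then show ?thesis
    unfolding step_distribution_def using assms
    by (subst integrable_density) (auto simp: step_density_nonneg)
qed

lemma AE_step_distribution_nonneg: "AE y in step_distribution \<beta>. 0 \<le> y"
  unfolding step_distribution_def by (subst AE_density) (auto simp: step_density_def)

text \<open>Strict positivity lets the moment cancel in the asymptotic ratio. A vanishing moment
  would force \<open>y = 0\<close> almost everywhere where the density is positive, contradicting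
  the positive length of \<open>{0<..1}\<close>.\<close>

lemma integral_step_distribution_powr_pos:
  assumes "0 < \<delta>" "\<delta> < \<beta>"
  shows "0 < integral\<^sup>L (step_distribution \<beta>) (\<lambda>y. y powr \<delta>)"
proof -
  have "\<not> (AE y in step_distribution \<beta>. y powr \<delta> = 0)"
  proof
    assume "AE y in step_distribution \<beta>. y powr \<delta> = 0"
    then have "AE y in lborel. 0 < step_density \<beta> y \<longrightarrow> y = 0"
      unfolding step_distribution_def by (subst (asm) AE_density) auto
    then have "AE y in lborel. y \<notin> {0<..(1::real)}"
      by (rule eventually_mono) (use assms in \<open>auto simp: step_density_def\<close>)
    then have "emeasure lborel {0<..(1::real)} = 0"
      by (subst (asm) AE_iff_measurable[where N="{0<..1}"]) auto
    then show False by simp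
  qed
  then have "integral\<^sup>L (step_distribution \<beta>) (\<lambda>y. y powr \<delta>) \<noteq> 0"
    by (subst integral_nonneg_eq_0_iff_AE) (auto intro!: integrable_step_distribution_powr assms)
  moreover have "0 \<le> integral\<^sup>L (step_distribution \<beta>) (\<lambda>y. y powr \<delta>)"
    by simp
  ultimately show ?thesis by linarith
qed

section \<open>Logarithmic growth of the harmonic sum\<close>

lemma harmonic_tail_over_ln_tendsto: "(\<lambda>n. (\<Sum>t=2..n. 1 / real t) / ln (real n)) \<longlonglongrightarrow> 1"
proof -
  \<comment> \<open>The extra \<open>- 1\<close> removes the term \<open>t = 1\<close> of
    \<open>harm n\<close>. The first factor converges, so division by the logarithm sends the
    product to 0.\<close>
  have "(\<lambda>n. (harm n - ln (real n) - 1) * inverse (ln (real n)) + 1) \<longlonglongrightarrow> (euler_mascheroni - 1) * 0 + (1::real)"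
    by (intro tendsto_intros euler_mascheroni_LIMSEQ tendsto_inverse_0_at_top) real_asymp
  then have "(\<lambda>n. (harm n - ln (real n) - 1) * inverse (ln (real n)) + 1) \<longlonglongrightarrow> (1::real)"
    by simp
  then show ?thesis
  proof (rule Lim_transform_eventually)
    show "\<forall>\<^sub>F n in sequentially. (harm n - ln (real n) - 1) * inverse (ln (real n)) + 1
        = (\<Sum>t=2..n. 1 / real t) / ln (real n)"
      using eventually_gt_at_top[of 1]
    proof eventually_elim
      case (elim n)
      have "harm n = 1 + (\<Sum>t=2..n. 1 / real t)"
        unfolding harm_def using elim
        by (subst sum.atLeast_Suc_atMost) (simp_all add: numeral_2_eq_2 inverse_eq_divide)
      then show ?case using elim by (simp add: field_simps)
    qed
  qed
qed

section \<open>Independence of sigma-algebras generated by disjoint sets of choices\<close>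

lemma Int_stable_events_of: "Int_stable (events_of M N Z)"
proof (rule Int_stableI)
  fix a b assume "a \<in> events_of M N Z" "b \<in> events_of M N Z"
  then obtain A B where "A \<in> sets N" "a = Z -` A \<inter> space M" "B \<in> sets N" "b = Z -` B \<inter> space M"
    unfolding events_of_def by blast
  then have "a \<inter> b = Z -` (A \<inter> B) \<inter> space M" "A \<inter> B \<in> sets N" by auto
  then show "a \<inter> b \<in> events_of M N Z"
    unfolding events_of_def by blast
qed

context preferential_placement
begin

definition choice_events :: "nat \<times> choice \<Rightarrow> 'w set set" where
  "choice_events = (\<lambda>(t, c). case c of
     Index \<Rightarrow> events_of M (count_space {1..<t}) (idx t)
   | Step \<Rightarrow> events_of M borel (step t)
   | Direction \<Rightarrow> events_of M borel (dir t))"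

text \<open>Only the sigma-algebra matters here. Measurability with respect to
  \<open>generated K\<close> expresses that a variable depends on the choices in \<open>K\<close>
  alone.\<close>

definition generated :: "(nat \<times> choice) set \<Rightarrow> 'w measure" where
  "generated K = sigma (space M) (\<Union>k\<in>K. choice_events k)"

lemma choice_events_subset_Pow: "choice_events k \<subseteq> Pow (space M)"
  by (cases k) (auto simp: choice_events_def events_of_def split: choice.splits)

lemma space_generated [simp]: "space (generated K) = space M"
  unfolding generated_def by (rule space_measure_of) (use choice_events_subset_Pow in blast)

lemma sets_generated: "sets (generated K) = sigma_sets (space M) (\<Union>k\<in>K. choice_events k)"
  unfolding generated_def by (rule sets_measure_of) (use choice_events_subset_Pow in blast)

lemma choice_events_subset_generated: "k \<in> K \<Longrightarrow> choice_events k \<subseteq> sets (generated K)"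
  unfolding sets_generated by auto

lemma indep_choice_events: "indep_sets choice_events ({2..} \<times> UNIV)"
  using choices_indep unfolding choice_events_def .

lemma sets_generated_subset:
  assumes "K \<subseteq> {2..} \<times> UNIV"
  shows "sets (generated K) \<subseteq> events"
  unfolding sets_generated using assms indep_choice_events
  by (intro sets.sigma_sets_subset) (force simp: indep_sets_def)

lemma measurable_from_generated:
  assumes "K \<subseteq> {2..} \<times> UNIV" "X \<in> measurable (generated K) S"
  shows "X \<in> measurable M S"
  using assms sets_generated_subset[of K] by (auto simp: measurable_def)

lemma generated_mono: "K \<subseteq> L \<Longrightarrow> sets (generated K) \<subseteq> sets (generated L)"
  unfolding sets_generated by (intro sigma_sets_mono') auto

lemma measurable_generated_mono:
  assumes "K \<subseteq> L" "X \<in> measurable (generated K) S"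
  shows "X \<in> measurable (generated L) S"
  using assms generated_mono[of K L] by (auto simp: measurable_def)

text \<open>Grouping principle: disjoint blocks of an independent family of intersection-stable
  systems generate independent sigma-algebras. The two blocks are indexed by a Boolean.\<close>

lemma indep_set_generated:
  assumes K: "K \<subseteq> {2..} \<times> UNIV" and L: "L \<subseteq> {2..} \<times> UNIV" and disj: "K \<inter> L = {}"
  shows "indep_set (sets (generated K)) (sets (generated L))"
proof -
  have "indep_sets (\<lambda>b. sigma_sets (space M) (\<Union>k\<in>case_bool K L b. choice_events k)) UNIV"
  proof (rule indep_sets_collect_sigma)
    show "indep_sets choice_events (\<Union>b\<in>UNIV. case_bool K L b)"
      by (rule indep_sets_mono_index[OF _ indep_choice_events]) (use K L in \<open>auto split: bool.splits\<close>)
    show "Int_stable (choice_events k)" for k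
      by (cases k) (auto simp: choice_events_def Int_stable_events_of split: choice.splits)
    show "disjoint_family_on (case_bool K L) UNIV"
      using disj by (auto simp: disjoint_family_on_def split: bool.splits)
  qed
  then have ind: "indep_sets (\<lambda>b. sets (generated (case_bool K L b))) UNIV"
    unfolding sets_generated .
  show ?thesis
    unfolding indep_set_def by (intro indep_sets_mono_sets[OF ind]) (auto split: bool.splits)
qed

text \<open>The sigma-algebras generated by \<open>X\<close> and \<open>Y\<close> are contained in
  those of the two blocks, and independence passes to smaller systems.\<close>

lemma indep_var_generated:
  assumes K: "K \<subseteq> {2..} \<times> UNIV" and L: "L \<subseteq> {2..} \<times> UNIV" and disj: "K \<inter> L = {}"
    and X: "X \<in> measurable (generated K) S" and Y: "Y \<in> measurable (generated L) T"
  shows "indep_var S X T Y"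
proof -
  have X_sub: "sigma_sets (space M) {X -` A \<inter> space M |A. A \<in> sets S} \<subseteq> sets (generated K)"
    using measurable_sets[OF X] by (intro sets.sigma_sets_subset[of _ "generated K", simplified]) auto
  have Y_sub: "sigma_sets (space M) {Y -` A \<inter> space M |A. A \<in> sets T} \<subseteq> sets (generated L)"
    using measurable_sets[OF Y] by (intro sets.sigma_sets_subset[of _ "generated L", simplified]) auto
  have "indep_set (sigma_sets (space M) {X -` A \<inter> space M |A. A \<in> sets S})
      (sigma_sets (space M) {Y -` A \<inter> space M |A. A \<in> sets T})"
    unfolding indep_set_def
    by (rule indep_sets_mono_sets[OF indep_set_generated[OF K L disj, unfolded indep_set_def]])
      (use X_sub Y_sub in \<open>auto split: bool.splits\<close>)
  then show ?thesis
    using measurable_from_generated K L X Y by (auto simp: indep_var_eq)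
qed

text \<open>\<^const>\<open>indep_var\<close> requires both random variables to have the same value type, so the factorisation
  of a joint distribution is derived here for arbitrary types.\<close>

lemma distr_pair_generated:
  assumes K: "K \<subseteq> {2..} \<times> UNIV" and L: "L \<subseteq> {2..} \<times> UNIV" and disj: "K \<inter> L = {}"
    and X: "X \<in> measurable (generated K) S" and Y: "Y \<in> measurable (generated L) T"
  shows "distr M S X \<Otimes>\<^sub>M distr M T Y = distr M (S \<Otimes>\<^sub>M T) (\<lambda>\<omega>. (X \<omega>, Y \<omega>))"
proof (rule pair_measure_eqI)
  have [measurable]: "X \<in> measurable M S" "Y \<in> measurable M T"
    using measurable_from_generated K L X Y by auto
  interpret X: prob_space "distr M S X" by (rule prob_space_distr) measurable
  interpret Y: prob_space "distr M T Y" by (rule prob_space_distr) measurable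
  show "sigma_finite_measure (distr M S X)" "sigma_finite_measure (distr M T Y)"
    by unfold_locales
  show "sets (distr M S X \<Otimes>\<^sub>M distr M T Y) = sets (distr M (S \<Otimes>\<^sub>M T) (\<lambda>\<omega>. (X \<omega>, Y \<omega>)))"
    by (simp cong: sets_pair_measure_cong)
  fix A B assume "A \<in> sets (distr M S X)" "B \<in> sets (distr M T Y)"
  then have [measurable]: "A \<in> sets S" "B \<in> sets T" by auto
  have "prob ((X -` A \<inter> space M) \<inter> (Y -` B \<inter> space M)) = prob (X -` A \<inter> space M) * prob (Y -` B \<inter> space M)"
    using measurable_sets[OF X, of A] measurable_sets[OF Y, of B]
    by (intro indep_setD[OF indep_set_generated[OF K L disj]]) auto
  moreover have "(\<lambda>\<omega>. (X \<omega>, Y \<omega>)) -` (A \<times> B) \<inter> space M = (X -` A \<inter> space M) \<inter> (Y -` B \<inter> space M)"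
    by auto
  ultimately show "emeasure (distr M S X) A * emeasure (distr M T Y) B
      = emeasure (distr M (S \<Otimes>\<^sub>M T) (\<lambda>\<omega>. (X \<omega>, Y \<omega>))) (A \<times> B)"
    by (simp add: emeasure_distr emeasure_eq_measure ennreal_mult)
qed

section \<open>Which choices determine the points of the process\<close>

lemma idx_generated:
  "t \<ge> 2 \<Longrightarrow> (t, Index) \<in> K \<Longrightarrow> idx t \<in> measurable (generated K) (count_space {1..<t})"
  using choice_events_subset_generated[of "(t, Index)" K] measurable_space[OF idx_measurable[of t]]
  by (intro measurableI) (auto simp: choice_events_def events_of_def)

lemma step_generated: "(t, Step) \<in> K \<Longrightarrow> step t \<in> borel_measurable (generated K)"
  using choice_events_subset_generated[of "(t, Step)" K]
  by (intro measurableI) (auto simp: choice_events_def events_of_def)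

lemma dir_generated: "(t, Direction) \<in> K \<Longrightarrow> dir t \<in> borel_measurable (generated K)"
  using choice_events_subset_generated[of "(t, Direction)" K]
  by (intro measurableI) (auto simp: choice_events_def events_of_def)

text \<open>A point with a random index is measurable because the index takes countably many
  values.\<close>

lemma parent_generated:
  assumes "t \<ge> 2" "(t, Index) \<in> K" "\<And>i. 1 \<le> i \<Longrightarrow> i < t \<Longrightarrow> x i \<in> borel_measurable (generated K)"
  shows "(\<lambda>\<omega>. x (idx t \<omega>) \<omega>) \<in> borel_measurable (generated K)"
  by (rule measurable_compose_countable'[OF _ idx_generated]) (use assms in auto)

text \<open>This makes \<open>x t\<close> independent of all choices made after time
  \<open>t\<close>. The induction is strong because the parent may be any earlier point.\<close>

lemma x_generated: "1 \<le> t \<Longrightarrow> x t \<in> borel_measurable (generated ({2..t} \<times> UNIV))"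
proof (induction t rule: less_induct)
  case (less t)
  show ?case
  proof (cases "t = 1")
    case True
    then show ?thesis
      using x_first by (subst measurable_cong[of _ _ "\<lambda>_. 0"]) auto
  next
    case False
    then obtain s where s: "t = Suc s" "1 \<le> s"
      using less.prems by (cases t) auto
    have "x i \<in> borel_measurable (generated ({2..t} \<times> UNIV))" if "1 \<le> i" "i < t" for i
      using less.IH[OF that(2,1)] that by (auto intro: measurable_generated_mono[rotated])
    then have "(\<lambda>\<omega>. x (idx t \<omega>) \<omega> + step t \<omega> *\<^sub>R dir t \<omega>) \<in> borel_measurable (generated ({2..t} \<times> UNIV))"
      using s by (intro borel_measurable_add borel_measurable_scaleR parent_generated step_generated dir_generated) auto
    then show ?thesis
      using x_next[of s] s by (subst measurable_cong) auto
  qed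
qed

lemma x_measurable: "1 \<le> t \<Longrightarrow> x t \<in> borel_measurable M"
  by (rule measurable_from_generated[OF _ x_generated]) auto

lemma parent_measurable:
  assumes "t \<ge> 2"
  shows "(\<lambda>\<omega>. x (idx t \<omega>) \<omega>) \<in> borel_measurable M"
  by (rule measurable_compose_countable'[OF _ idx_measurable]) (use assms x_measurable in auto)

section \<open>Laws of the parent and of the displacement\<close>

lemma prob_idx:
  assumes "t \<ge> 1" "i \<in> {1..t}"
  shows "prob {\<omega> \<in> space M. idx (Suc t) \<omega> = i} = 1 / real t"
proof -
  have "prob {\<omega> \<in> space M. idx (Suc t) \<omega> = i}
      = measure (distr M (count_space {1..<Suc t}) (idx (Suc t))) {i}"
    using assms idx_measurable[of "Suc t"] by (subst measure_distr) (auto intro!: arg_cong[where f=prob])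
  also have "\<dots> = 1 / real t"
    using assms by (subst idx_uniform) (simp_all add: measure_uniform_count_measure)
  finally show ?thesis .
qed

text \<open>The value at the parent is split according to the index. For \<open>i \<le> t\<close>
  the point \<open>x i\<close> is independent of the index drawn at time \<open>Suc t\<close>, so
  each product has an expectation that factorises with weight \<open>1 / real t\<close>.\<close>

lemma parent_expectation:
  fixes f :: "'a \<Rightarrow> real"
  assumes t: "t \<ge> 1" and f [measurable]: "f \<in> borel_measurable borel"
    and int: "\<And>i. i \<in> {1..t} \<Longrightarrow> integrable M (\<lambda>\<omega>. f (x i \<omega>))"
  shows "integrable M (\<lambda>\<omega>. f (x (idx (Suc t) \<omega>) \<omega>))"
    and "expectation (\<lambda>\<omega>. f (x (idx (Suc t) \<omega>) \<omega>)) = (\<Sum>i=1..t. expectation (\<lambda>\<omega>. f (x i \<omega>))) / real t"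
proof -
  \<comment> \<open>A real-valued indicator, so that it shares its value type with
    \<open>f (x i \<omega>)\<close> as \<open>indep_var\<close> demands.\<close>
  define J where "J i \<omega> = indicat_real {i} (idx (Suc t) \<omega>)" for i \<omega>
  have idx_range: "idx (Suc t) \<omega> \<in> {1..t}" if "\<omega> \<in> space M" for \<omega>
    using measurable_space[OF idx_measurable[of "Suc t"] that] t by auto
  have split: "f (x (idx (Suc t) \<omega>) \<omega>) = (\<Sum>i=1..t. J i \<omega> * f (x i \<omega>))" if "\<omega> \<in> space M" for \<omega>
    using idx_range[OF that] by (simp add: J_def indicator_def if_distrib sum.delta cong: if_cong)
  have J_generated: "J i \<in> borel_measurable (generated {(Suc t, Index)})" for i
    unfolding J_def using t by (intro measurable_compose[OF idx_generated]) auto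
  have J_meas: "J i \<in> borel_measurable M" for i
    using t by (intro measurable_from_generated[OF _ J_generated]) auto
  have J_int: "integrable M (J i)" for i
    by (rule integrable_const_bound[where B=1]) (auto simp: J_def J_meas indicator_def)
  have J_exp: "expectation (J i) = 1 / real t" if "i \<in> {1..t}" for i
  proof -
    have "expectation (J i) = expectation (indicat_real {\<omega> \<in> space M. idx (Suc t) \<omega> = i})"
      by (intro Bochner_Integration.integral_cong) (auto simp: J_def indicator_def)
    also have "\<dots> = prob {\<omega> \<in> space M. idx (Suc t) \<omega> = i}"
      by (simp add: Int_absorb2)
    finally show ?thesis
      using prob_idx[OF t that] by simp
  qed
  have ind: "indep_var borel (J i) borel (\<lambda>\<omega>. f (x i \<omega>))" if "i \<in> {1..t}" for i
  proof (rule indep_var_generated[OF _ _ _ J_generated])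
    show "(\<lambda>\<omega>. f (x i \<omega>)) \<in> borel_measurable (generated ({2..i} \<times> UNIV))"
      using that by (intro measurable_compose[OF x_generated f]) auto
  qed (use that t in auto)
  note int_i = indep_var_integrable[OF ind J_int int] and exp_i = indep_var_lebesgue_integral[OF ind J_int int]
  show "integrable M (\<lambda>\<omega>. f (x (idx (Suc t) \<omega>) \<omega>))"
    by (subst Bochner_Integration.integrable_cong[OF refl split])
      (auto intro!: Bochner_Integration.integrable_sum int_i)
  have "expectation (\<lambda>\<omega>. f (x (idx (Suc t) \<omega>) \<omega>)) = (\<Sum>i=1..t. expectation (\<lambda>\<omega>. J i \<omega> * f (x i \<omega>)))"
    by (subst Bochner_Integration.integral_cong[OF refl split])
      (auto intro!: Bochner_Integration.integral_sum int_i)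
  also have "\<dots> = (\<Sum>i=1..t. expectation (\<lambda>\<omega>. f (x i \<omega>)) / real t)"
    by (intro sum.cong refl) (simp add: exp_i J_exp)
  finally show "expectation (\<lambda>\<omega>. f (x (idx (Suc t) \<omega>) \<omega>)) = (\<Sum>i=1..t. expectation (\<lambda>\<omega>. f (x i \<omega>))) / real t"
    by (simp add: sum_divide_distrib)
qed

text \<open>Parent and step length use none of the information in the new direction, so the joint
  law is a product, and its direction factor is invariant under reflection.\<close>

lemma distr_reflect_dir:
  assumes t: "t \<ge> 1"
  shows "distr M ((borel \<Otimes>\<^sub>M borel) \<Otimes>\<^sub>M borel)
      (\<lambda>\<omega>. ((x (idx (Suc t) \<omega>) \<omega>, step (Suc t) \<omega>), - dir (Suc t) \<omega>))
    = distr M ((borel \<Otimes>\<^sub>M borel) \<Otimes>\<^sub>M borel)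
      (\<lambda>\<omega>. ((x (idx (Suc t) \<omega>) \<omega>, step (Suc t) \<omega>), dir (Suc t) \<omega>))"
proof -
  let ?Z = "\<lambda>\<omega>. (x (idx (Suc t) \<omega>) \<omega>, step (Suc t) \<omega>)"
  let ?K = "{2..t} \<times> UNIV \<union> {(Suc t, Index), (Suc t, Step)}" and ?L = "{(Suc t, Direction)}"
  have "x i \<in> borel_measurable (generated ?K)" if "1 \<le> i" "i < Suc t" for i
    by (rule measurable_generated_mono[OF _ x_generated]) (use that in auto)
  then have Z: "?Z \<in> measurable (generated ?K) (borel \<Otimes>\<^sub>M borel)"
    using t by (intro measurable_Pair parent_generated step_generated) auto
  have D: "dir (Suc t) \<in> borel_measurable (generated ?L)"
    by (intro dir_generated) auto
  then have D': "(\<lambda>\<omega>. - dir (Suc t) \<omega>) \<in> borel_measurable (generated ?L)"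
    by simp
  have "distr M (borel \<Otimes>\<^sub>M borel) ?Z \<Otimes>\<^sub>M distr M borel (dir (Suc t))
      = distr M ((borel \<Otimes>\<^sub>M borel) \<Otimes>\<^sub>M borel) (\<lambda>\<omega>. (?Z \<omega>, dir (Suc t) \<omega>))"
    by (rule distr_pair_generated[OF _ _ _ Z D]) (use t in auto)
  moreover have "distr M (borel \<Otimes>\<^sub>M borel) ?Z \<Otimes>\<^sub>M distr M borel (\<lambda>\<omega>. - dir (Suc t) \<omega>)
      = distr M ((borel \<Otimes>\<^sub>M borel) \<Otimes>\<^sub>M borel) (\<lambda>\<omega>. (?Z \<omega>, - dir (Suc t) \<omega>))"
    by (rule distr_pair_generated[OF _ _ _ Z D']) (use t in auto)
  moreover have "distr M borel (\<lambda>\<omega>. - dir (Suc t) \<omega>) = distr (distr M borel (dir (Suc t))) borel uminus"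
    using t dir_measurable[of "Suc t"] by (subst distr_distr) (auto simp: comp_def)
  moreover have "\<dots> = distr M borel (dir (Suc t))"
    using t by (simp add: dir_uniform distr_sphere_uniform_uminus)
  ultimately show ?thesis
    by simp
qed

text \<open>Directions have norm 1 only almost surely, hence the almost-everywhere congruences. The
  absolute value appears because the locale allows \<Xi> to charge negative numbers.\<close>

lemma displacement_expectation:
  assumes t: "t \<ge> 2" and int: "integrable \<Xi> (\<lambda>y. \<bar>y\<bar> powr \<delta>)"
  shows "integrable M (\<lambda>\<omega>. norm (step t \<omega> *\<^sub>R dir t \<omega>) powr \<delta>)"
    and "expectation (\<lambda>\<omega>. norm (step t \<omega> *\<^sub>R dir t \<omega>) powr \<delta>) = integral\<^sup>L \<Xi> (\<lambda>y. \<bar>y\<bar> powr \<delta>)"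
proof -
  have [measurable]: "step t \<in> borel_measurable M" "dir t \<in> borel_measurable M"
    using t step_measurable dir_measurable by auto
  have "AE \<omega> in M. norm (dir t \<omega>) = 1"
    using AE_sphere_uniform_norm[where 'a='a] t
    by (subst (asm) dir_uniform[OF t, symmetric], subst (asm) AE_distr_iff) auto
  then have eq: "AE \<omega> in M. norm (step t \<omega> *\<^sub>R dir t \<omega>) powr \<delta> = \<bar>step t \<omega>\<bar> powr \<delta>"
    by eventually_elim simp
  show "integrable M (\<lambda>\<omega>. norm (step t \<omega> *\<^sub>R dir t \<omega>) powr \<delta>)"
    using int unfolding step_distr[OF t, symmetric]
    by (subst integrable_cong_AE[OF _ _ eq]) (auto simp: integrable_distr_eq)
  show "expectation (\<lambda>\<omega>. norm (step t \<omega> *\<^sub>R dir t \<omega>) powr \<delta>) = integral\<^sup>L \<Xi> (\<lambda>y. \<bar>y\<bar> powr \<delta>)"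
    unfolding step_distr[OF t, symmetric]
    by (subst integral_cong_AE[OF _ _ eq]) (auto simp: integral_distr)
qed

section \<open>Recursion for the expected powers of the norm\<close>

lemma next_expectation:
  assumes t: "t \<ge> 1" and \<delta>: "0 < \<delta>" "\<delta> \<le> 2" and int_\<Xi>: "integrable \<Xi> (\<lambda>y. \<bar>y\<bar> powr \<delta>)"
    and int: "\<And>i. i \<in> {1..t} \<Longrightarrow> integrable M (\<lambda>\<omega>. norm (x i \<omega>) powr \<delta>)"
  defines "m \<equiv> integral\<^sup>L \<Xi> (\<lambda>y. \<bar>y\<bar> powr \<delta>)"
    and "a \<equiv> (\<Sum>i=1..t. expectation (\<lambda>\<omega>. norm (x i \<omega>) powr \<delta>)) / real t"
  shows "integrable M (\<lambda>\<omega>. norm (x (Suc t) \<omega>) powr \<delta>)"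
    and "expectation (\<lambda>\<omega>. norm (x (Suc t) \<omega>) powr \<delta>) \<le> a + m"
    and "\<delta> = 2 \<Longrightarrow> expectation (\<lambda>\<omega>. norm (x (Suc t) \<omega>) powr \<delta>) = a + m"
proof -
  define y where "y \<omega> = x (idx (Suc t) \<omega>) \<omega>" for \<omega>
  define v where "v \<omega> = step (Suc t) \<omega> *\<^sub>R dir (Suc t) \<omega>" for \<omega>
  have [measurable]: "y \<in> borel_measurable M" "step (Suc t) \<in> borel_measurable M" "dir (Suc t) \<in> borel_measurable M"
    unfolding y_def using t parent_measurable[of "Suc t"] step_measurable dir_measurable by auto
  then have [measurable]: "v \<in> borel_measurable M"
    unfolding v_def by measurable
  have next_eq: "x (Suc t) \<omega> = y \<omega> + v \<omega>" if "\<omega> \<in> space M" for \<omega>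
    using x_next[OF t that] by (simp add: y_def v_def)
  have int_y: "integrable M (\<lambda>\<omega>. norm (y \<omega>) powr \<delta>)"
    and exp_y: "expectation (\<lambda>\<omega>. norm (y \<omega>) powr \<delta>) = a"
    unfolding y_def a_def
    using parent_expectation[OF t, of "\<lambda>z. norm z powr \<delta>"] int by simp_all
  have int_v: "integrable M (\<lambda>\<omega>. norm (v \<omega>) powr \<delta>)"
    and exp_v: "expectation (\<lambda>\<omega>. norm (v \<omega>) powr \<delta>) = m"
    unfolding v_def m_def using displacement_expectation[of "Suc t" \<delta>] t int_\<Xi> by auto
  have int_bound: "integrable M (\<lambda>\<omega>. 2 * (norm (y \<omega>) powr \<delta> + norm (v \<omega>) powr \<delta>))"
    using int_y int_v by auto
  have exp_bound: "expectation (\<lambda>\<omega>. 2 * (norm (y \<omega>) powr \<delta> + norm (v \<omega>) powr \<delta>)) = 2 * (a + m)"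
    using int_y int_v exp_y exp_v by simp
  \<comment> \<open>Both summands are nonnegative, so this one bound also dominates each of them and
    yields their integrability.\<close>
  have le: "norm (y \<omega> + v \<omega>) powr \<delta> + norm (y \<omega> - v \<omega>) powr \<delta>
      \<le> 2 * (norm (y \<omega>) powr \<delta> + norm (v \<omega>) powr \<delta>)" for \<omega>
    by (rule norm_powr_parallelogram_le[OF \<delta>])
  have int_plus: "integrable M (\<lambda>\<omega>. norm (y \<omega> + v \<omega>) powr \<delta>)"
  proof (rule Bochner_Integration.integrable_bound[OF int_bound _ AE_I2])
    show "norm (norm (y \<omega> + v \<omega>) powr \<delta>) \<le> norm (2 * (norm (y \<omega>) powr \<delta> + norm (v \<omega>) powr \<delta>))" for \<omega>
      using le[of \<omega>] by simp (smt (verit) powr_ge_zero)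
  qed simp
  have int_minus: "integrable M (\<lambda>\<omega>. norm (y \<omega> - v \<omega>) powr \<delta>)"
  proof (rule Bochner_Integration.integrable_bound[OF int_bound _ AE_I2])
    show "norm (norm (y \<omega> - v \<omega>) powr \<delta>) \<le> norm (2 * (norm (y \<omega>) powr \<delta> + norm (v \<omega>) powr \<delta>))" for \<omega>
      using le[of \<omega>] by simp (smt (verit) powr_ge_zero)
  qed simp
  \<comment> \<open>Written as a function of parent, step length and direction, so that negating the
    direction turns \<open>y + v\<close> into \<open>y - v\<close> and
    \<open>distr_reflect_dir\<close> applies.\<close>
  define g :: "('a \<times> real) \<times> 'a \<Rightarrow> real" where "g = (\<lambda>p. norm (fst (fst p) + snd (fst p) *\<^sub>R snd p) powr \<delta>)"
  have g [measurable]: "g \<in> borel_measurable ((borel \<Otimes>\<^sub>M borel) \<Otimes>\<^sub>M borel)"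
    unfolding g_def by measurable
  have "expectation (\<lambda>\<omega>. norm (y \<omega> - v \<omega>) powr \<delta>) = expectation (\<lambda>\<omega>. g ((y \<omega>, step (Suc t) \<omega>), - dir (Suc t) \<omega>))"
    by (simp add: g_def v_def)
  also have "\<dots> = expectation (\<lambda>\<omega>. g ((y \<omega>, step (Suc t) \<omega>), dir (Suc t) \<omega>))"
    using arg_cong[OF distr_reflect_dir[OF t], of "\<lambda>D. integral\<^sup>L D g"]
    unfolding y_def[symmetric] by (simp add: integral_distr)
  also have "\<dots> = expectation (\<lambda>\<omega>. norm (y \<omega> + v \<omega>) powr \<delta>)"
    by (simp add: g_def v_def)
  \<comment> \<open>The factor 2 cancels the one in the bound, leaving \<open>a + m\<close>.\<close>
  finally have reflect: "expectation (\<lambda>\<omega>. norm (y \<omega> + v \<omega>) powr \<delta> + norm (y \<omega> - v \<omega>) powr \<delta>)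
      = 2 * expectation (\<lambda>\<omega>. norm (y \<omega> + v \<omega>) powr \<delta>)"
    using int_plus int_minus by simp
  have x_eq: "expectation (\<lambda>\<omega>. norm (x (Suc t) \<omega>) powr \<delta>) = expectation (\<lambda>\<omega>. norm (y \<omega> + v \<omega>) powr \<delta>)"
    by (intro Bochner_Integration.integral_cong) (simp_all add: next_eq)
  show "integrable M (\<lambda>\<omega>. norm (x (Suc t) \<omega>) powr \<delta>)"
    using int_plus by (subst Bochner_Integration.integrable_cong[OF refl]) (simp_all add: next_eq)
  have "expectation (\<lambda>\<omega>. norm (y \<omega> + v \<omega>) powr \<delta> + norm (y \<omega> - v \<omega>) powr \<delta>)
      \<le> expectation (\<lambda>\<omega>. 2 * (norm (y \<omega>) powr \<delta> + norm (v \<omega>) powr \<delta>))"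
    using int_plus int_minus int_bound le by (intro integral_mono) auto
  then show "expectation (\<lambda>\<omega>. norm (x (Suc t) \<omega>) powr \<delta>) \<le> a + m"
    unfolding reflect exp_bound x_eq by simp
  assume "\<delta> = 2"
  then have "expectation (\<lambda>\<omega>. norm (y \<omega> + v \<omega>) powr \<delta> + norm (y \<omega> - v \<omega>) powr \<delta>)
      = expectation (\<lambda>\<omega>. 2 * (norm (y \<omega>) powr \<delta> + norm (v \<omega>) powr \<delta>))"
    by (simp only: norm_powr_2_parallelogram)
  then show "expectation (\<lambda>\<omega>. norm (x (Suc t) \<omega>) powr \<delta>) = a + m"
    unfolding reflect exp_bound x_eq by simp
qed

text \<open>Strong induction, since \<open>next_expectation\<close> requires integrability for every
  possible parent.\<close>

lemma integrable_norm_powr: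
  assumes "t \<ge> 1" "0 < \<delta>" "\<delta> \<le> 2" "integrable \<Xi> (\<lambda>y. \<bar>y\<bar> powr \<delta>)"
  shows "integrable M (\<lambda>\<omega>. norm (x t \<omega>) powr \<delta>)"
  using assms(1)
proof (induction t rule: less_induct)
  case (less t)
  show ?case
  proof (cases "t = 1")
    case True
    then show ?thesis
      by (subst Bochner_Integration.integrable_cong[where g="\<lambda>_. 0", OF refl]) (simp_all add: x_first[simplified])
  next
    case False
    then obtain s where "t = Suc s" "s \<ge> 1"
      using less.prems by (cases t) auto
    then show ?thesis
      using less.IH assms by (auto intro!: next_expectation(1))
  qed
qed

lemma mean_norm_powr_expectation:
  assumes n: "n \<ge> 1" and \<delta>: "0 < \<delta>" "\<delta> \<le> 2" and int_\<Xi>: "integrable \<Xi> (\<lambda>y. \<bar>y\<bar> powr \<delta>)"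
  defines "m \<equiv> integral\<^sup>L \<Xi> (\<lambda>y. \<bar>y\<bar> powr \<delta>)"
  shows "integrable M (mean_norm_powr x \<delta> n)"
    and "expectation (mean_norm_powr x \<delta> n) \<le> m * (\<Sum>t=2..n. 1 / real t)"
    and "\<delta> = 2 \<Longrightarrow> expectation (mean_norm_powr x \<delta> n) = m * (\<Sum>t=2..n. 1 / real t)"
proof -
  note int = integrable_norm_powr[OF _ \<delta> int_\<Xi>]
  define S where "S t = (\<Sum>i=1..t. expectation (\<lambda>\<omega>. norm (x i \<omega>) powr \<delta>)) / real t" for t
  show "integrable M (mean_norm_powr x \<delta> n)"
    unfolding mean_norm_powr_def
    by (intro integrable_mult_right Bochner_Integration.integrable_sum int) auto
  have exp_eq: "expectation (mean_norm_powr x \<delta> n) = S n"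
    unfolding mean_norm_powr_def S_def
    by (simp add: Bochner_Integration.integral_sum int)
  have S_1: "S 1 = 0"
    unfolding S_def by (simp add: x_first[simplified] cong: Bochner_Integration.integral_cong)
  \<comment> \<open>A new value moves the average by its deviation from the old average, divided by
    the new count. By \<open>next_expectation\<close> that deviation is at most \<open>m\<close>,
    with equality for \<open>\<delta> = 2\<close>.\<close>
  have S_Suc: "S (Suc t) = S t + (expectation (\<lambda>\<omega>. norm (x (Suc t) \<omega>) powr \<delta>) - S t) / real (Suc t)"
    if "t \<ge> 1" for t
  proof -
    have "real (Suc t) * S (Suc t) = real t * S t + expectation (\<lambda>\<omega>. norm (x (Suc t) \<omega>) powr \<delta>)"
      using that unfolding S_def by simp
    then show ?thesis
      by (simp add: field_simps)
  qed
  \<comment> \<open>The induction starts at 1, where \<open>S 1 = 0\<close> matches the empty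
    sum.\<close>
  have "S n \<le> m * (\<Sum>t=2..n. 1 / real t)"
    using n
  proof (induction n rule: dec_induct)
    case (step k)
    have "(expectation (\<lambda>\<omega>. norm (x (Suc k) \<omega>) powr \<delta>) - S k) / real (Suc k) \<le> m / real (Suc k)"
      using \<open>1 \<le> k\<close> next_expectation(2)[OF _ \<delta> int_\<Xi> int, of k, folded m_def S_def]
      by (intro divide_right_mono) auto
    then show ?case
      using step S_Suc[of k] by (simp add: distrib_left)
  qed (use S_1 in simp)
  then show "expectation (mean_norm_powr x \<delta> n) \<le> m * (\<Sum>t=2..n. 1 / real t)"
    unfolding exp_eq .
  assume \<delta>_2: "\<delta> = 2"
  have "S n = m * (\<Sum>t=2..n. 1 / real t)"
    using n
  proof (induction n rule: dec_induct)
    case (step k)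
    have "(expectation (\<lambda>\<omega>. norm (x (Suc k) \<omega>) powr \<delta>) - S k) / real (Suc k) = m / real (Suc k)"
      using \<open>1 \<le> k\<close> next_expectation(3)[OF _ \<delta> int_\<Xi> int \<delta>_2, of k, folded m_def S_def]
      by simp
    then show ?case
      using step S_Suc[of k] by (simp add: distrib_left)
  qed (use S_1 in simp)
  then show "expectation (mean_norm_powr x \<delta> n) = m * (\<Sum>t=2..n. 1 / real t)"
    unfolding exp_eq .
qed

end

section \<open>Specialisation to the given step density\<close>

lemma step_distribution_abs_powr:
  assumes "0 < \<delta>" "\<delta> < \<beta>"
  shows "integrable (step_distribution \<beta>) (\<lambda>y. \<bar>y\<bar> powr \<delta>)"
    and "integral\<^sup>L (step_distribution \<beta>) (\<lambda>y. \<bar>y\<bar> powr \<delta>) = integral\<^sup>L (step_distribution \<beta>) (\<lambda>y. y powr \<delta>)"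
proof -
  have eq: "AE y in step_distribution \<beta>. \<bar>y\<bar> powr \<delta> = y powr \<delta>"
    using AE_step_distribution_nonneg by eventually_elim simp
  show "integrable (step_distribution \<beta>) (\<lambda>y. \<bar>y\<bar> powr \<delta>)"
    using integrable_step_distribution_powr[OF assms] by (subst integrable_cong_AE[OF _ _ eq]) auto
  show "integral\<^sup>L (step_distribution \<beta>) (\<lambda>y. \<bar>y\<bar> powr \<delta>) = integral\<^sup>L (step_distribution \<beta>) (\<lambda>y. y powr \<delta>)"
    by (rule integral_cong_AE[OF _ _ eq]) auto
qed

theorem theorem2:
  fixes \<beta> :: real
    and M :: "'w measure"
    and idx :: "nat \<Rightarrow> 'w \<Rightarrow> nat"
    and step :: "nat \<Rightarrow> 'w \<Rightarrow> real"
    and dir :: "nat \<Rightarrow> 'w \<Rightarrow> 'a::euclidean_space"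
    and x :: "nat \<Rightarrow> 'w \<Rightarrow> 'a"
    and N :: "'v measure"
    and \<xi> :: "'v \<Rightarrow> real"
  assumes "\<beta> > 0"
    and "preferential_placement M (step_distribution \<beta>) idx step dir x"
    and "prob_space N"
    and "\<xi> \<in> borel_measurable N"
    and "distr N borel \<xi> = step_distribution \<beta>"
  shows "(\<forall>\<delta>. 1 \<le> \<delta> \<and> \<delta> < min \<beta> 2 \<longrightarrow>
            integrable N (\<lambda>\<omega>. \<xi> \<omega> powr \<delta>) \<and>
            (\<forall>n\<ge>1. integrable M (mean_norm_powr x \<delta> n) \<and>
               integral\<^sup>L M (mean_norm_powr x \<delta> n)
                 \<le> integral\<^sup>L N (\<lambda>\<omega>. \<xi> \<omega> powr \<delta>) * (\<Sum>t=2..n. 1 / real t)) \<and>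
            (\<lambda>n. (integral\<^sup>L N (\<lambda>\<omega>. \<xi> \<omega> powr \<delta>) * (\<Sum>t=2..n. 1 / real t)) /
                 (integral\<^sup>L N (\<lambda>\<omega>. \<xi> \<omega> powr \<delta>) * ln (real n))) \<longlonglongrightarrow> 1) \<and>
         (\<beta> > 2 \<longrightarrow>
            integrable N (\<lambda>\<omega>. \<xi> \<omega> powr 2) \<and>
            (\<forall>n\<ge>1. integrable M (mean_norm_powr x 2 n) \<and>
               integral\<^sup>L M (mean_norm_powr x 2 n)
                 = integral\<^sup>L N (\<lambda>\<omega>. \<xi> \<omega> powr 2) * (\<Sum>t=2..n. 1 / real t)) \<and>
            (\<lambda>n. (integral\<^sup>L N (\<lambda>\<omega>. \<xi> \<omega> powr 2) * (\<Sum>t=2..n. 1 / real t)) /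
                 (integral\<^sup>L N (\<lambda>\<omega>. \<xi> \<omega> powr 2) * ln (real n))) \<longlonglongrightarrow> 1)"
proof -
  interpret preferential_placement M "step_distribution \<beta>" idx step dir x
    by fact
  \<comment> \<open>The range \<open>0 < \<delta> < \<beta>\<close> covers both the exponents of the
    first part and the exponent 2 when \<open>\<beta> > 2\<close>.\<close>
  have int_\<xi>: "integrable N (\<lambda>\<omega>. \<xi> \<omega> powr \<delta>)"
    and exp_\<xi>: "integral\<^sup>L N (\<lambda>\<omega>. \<xi> \<omega> powr \<delta>) = integral\<^sup>L (step_distribution \<beta>) (\<lambda>y. \<bar>y\<bar> powr \<delta>)"
    and ratio: "(\<lambda>n. (integral\<^sup>L N (\<lambda>\<omega>. \<xi> \<omega> powr \<delta>) * (\<Sum>t=2..n. 1 / real t)) /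
      (integral\<^sup>L N (\<lambda>\<omega>. \<xi> \<omega> powr \<delta>) * ln (real n))) \<longlonglongrightarrow> 1"
    if "0 < \<delta>" "\<delta> < \<beta>" for \<delta>
  proof -
    show "integrable N (\<lambda>\<omega>. \<xi> \<omega> powr \<delta>)"
      using integrable_step_distribution_powr[OF that] assms(4) unfolding assms(5)[symmetric]
      by (simp add: integrable_distr_eq)
    have eq: "integral\<^sup>L N (\<lambda>\<omega>. \<xi> \<omega> powr \<delta>) = integral\<^sup>L (step_distribution \<beta>) (\<lambda>y. y powr \<delta>)"
      using assms(4) unfolding assms(5)[symmetric] by (simp add: integral_distr)
    then show "integral\<^sup>L N (\<lambda>\<omega>. \<xi> \<omega> powr \<delta>) = integral\<^sup>L (step_distribution \<beta>) (\<lambda>y. \<bar>y\<bar> powr \<delta>)"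
      by (simp add: step_distribution_abs_powr(2)[OF that])
    have "integral\<^sup>L N (\<lambda>\<omega>. \<xi> \<omega> powr \<delta>) \<noteq> 0"
      unfolding eq using integral_step_distribution_powr_pos[OF that] by simp
    then show "(\<lambda>n. (integral\<^sup>L N (\<lambda>\<omega>. \<xi> \<omega> powr \<delta>) * (\<Sum>t=2..n. 1 / real t)) /
        (integral\<^sup>L N (\<lambda>\<omega>. \<xi> \<omega> powr \<delta>) * ln (real n))) \<longlonglongrightarrow> 1"
      using harmonic_tail_over_ln_tendsto by (subst mult_divide_mult_cancel_left) auto
  qed
  show ?thesis
  proof (intro conjI allI impI)
    fix \<delta> :: real and n :: nat
    assume \<delta>: "1 \<le> \<delta> \<and> \<delta> < min \<beta> 2" 
    show "integrable N (\<lambda>\<omega>. \<xi> \<omega> powr \<delta>)"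
      using \<delta> by (intro int_\<xi>) auto
    show "(\<lambda>n. (integral\<^sup>L N (\<lambda>\<omega>. \<xi> \<omega> powr \<delta>) * (\<Sum>t=2..n. 1 / real t)) /
        (integral\<^sup>L N (\<lambda>\<omega>. \<xi> \<omega> powr \<delta>) * ln (real n))) \<longlonglongrightarrow> 1"
      using \<delta> by (intro ratio) auto
    assume n: "n \<ge> 1"
    show "integrable M (mean_norm_powr x \<delta> n)"
      using \<delta> n by (intro mean_norm_powr_expectation step_distribution_abs_powr) auto
    show "integral\<^sup>L M (mean_norm_powr x \<delta> n)
        \<le> integral\<^sup>L N (\<lambda>\<omega>. \<xi> \<omega> powr \<delta>) * (\<Sum>t=2..n. 1 / real t)"
      using \<delta> n by (subst exp_\<xi>) (auto intro!: mean_norm_powr_expectation step_distribution_abs_powr)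
  next
    fix n :: nat
    assume \<beta>: "\<beta> > 2"
    show "integrable N (\<lambda>\<omega>. \<xi> \<omega> powr 2)"
      using \<beta> by (intro int_\<xi>) auto
    show "(\<lambda>n. (integral\<^sup>L N (\<lambda>\<omega>. \<xi> \<omega> powr 2) * (\<Sum>t=2..n. 1 / real t)) /
        (integral\<^sup>L N (\<lambda>\<omega>. \<xi> \<omega> powr 2) * ln (real n))) \<longlonglongrightarrow> 1"
      using \<beta> by (intro ratio) auto
    assume n: "n \<ge> 1"
    show "integrable M (mean_norm_powr x 2 n)"
      using \<beta> n by (intro mean_norm_powr_expectation step_distribution_abs_powr) auto
    show "integral\<^sup>L M (mean_norm_powr x 2 n)
        = integral\<^sup>L N (\<lambda>\<omega>. \<xi> \<omega> powr 2) * (\<Sum>t=2..n. 1 / real t)"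
      using \<beta> n step_distribution_abs_powr(1)[of 2 \<beta>] exp_\<xi>[of 2] mean_norm_powr_expectation(3)[of n 2]
      by simp
  qed
qed

end
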